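(* Let $\mu,a_1,a_2,p_1,p_2>0$, $T=p_1+p_2$, and let $$k=\Big(1-2\frac{a_2}{a_1}e^{\mu}\Big)e^{-\mu T},\qquad d=\frac{a_2-a_1}{\mu}e^{-\mu p_2}+\frac{a_1}{\mu}e^{-\mu T}+\frac{a_2}{\mu}\big[1-2e^{-\mu(T-1)}\big].$$ Assume $|k|<1$ and $d<0$, and put $h_*=-d/(k+1)>0$. Assume further that $p_2=T-p_1>1$, that $t_1:=\frac1\mu\ln\frac{\mu h_*+a_1}{a_1}$ satisfies $t_1<p_1<t_1+1<T$, and that the solution of $$\dot x(t)=-\mu x(t)+a(t)f(x(t-1))$$ with initial function $\varphi\equiv h_*$ on $[-1,0]$ is negative on $(t_1,T]$. Then this equation has a symmetric slowly oscillating periodic solution of period $2T$ satisfying $x(t+T)=-x(t)$ for all $t\in\mathbb R$. This solution can be obtained by starting with the initial function $\varphi\equiv h_*$.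
   Context: Here $f(x)=-\operatorname{sign}(x)$, that is, $f(x)=-1$ for $x>0$, $f(0)=0$, $f(x)=+1$ for $x<0$; and $a:\mathbb R\to\mathbb R$ is the $T$-periodic function with $a(t)=a_1$ for $0\le t<p_1$ and $a(t)=a_2$ for $p_1\le t<T$. A solution is a continuous function satisfying the equation at all times $t$ at which $a$ is continuous and $x(t-1)\neq0$ (equivalently, it satisfies the variation-of-constants formula). A solution is slowly oscillating if the distance between consecutive zeros is larger than the delay $1$. "Obtained by starting with $\varphi\equiv h_*$" means: if $y$ is the solution for $t\ge0$ with $y|_{[-1,0]}\equiv h_*$, then the periodic solution coincides with $y$ on $[0,\infty)$ (so its state at time $0$ is that of $y$ after time $2T$). *)

theory Defs
  imports Complex_Main
begin

definition neg_sign :: "real \<Rightarrow> real" where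
  "neg_sign x = - sgn x"

text \<open>
  The equation \<open>x'(t) = - \<mu> x(t) + a(t) f(x(t - 1))\<close>, imposed at time \<open>t\<close> only if \<open>a\<close> is
  continuous at \<open>t\<close> and \<open>x(t - 1) \<noteq> 0\<close>.  For a continuous \<open>x\<close> whose zeros are isolated and an \<open>a\<close>
  whose jumps are isolated, requiring this at all times is the same as the
  variation-of-constants formula; for an \<open>x\<close> vanishing on an interval it is weaker.
\<close>

definition dde_at ::
  "real \<Rightarrow> (real \<Rightarrow> real) \<Rightarrow> (real \<Rightarrow> real) \<Rightarrow> (real \<Rightarrow> real) \<Rightarrow> real \<Rightarrow> bool" where
  "dde_at \<mu> a f x t \<longleftrightarrow>
     (isCont a t \<and> x (t - 1) \<noteq> 0 \<longrightarrow>
       (x has_real_derivative (- \<mu> * x t + a t * f (x (t - 1)))) (at t))"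

text \<open>Values of \<open>y\<close> to the left of \<open>-1\<close> are irrelevant.\<close>

definition ivp_solution ::
  "real \<Rightarrow> (real \<Rightarrow> real) \<Rightarrow> (real \<Rightarrow> real) \<Rightarrow> (real \<Rightarrow> real) \<Rightarrow> (real \<Rightarrow> real) \<Rightarrow> bool" where
  "ivp_solution \<mu> a f \<phi> y \<longleftrightarrow>
     continuous_on {-1..} y \<and> (\<forall>t\<in>{-1..0}. y t = \<phi> t) \<and> (\<forall>t>0. dde_at \<mu> a f y t)"

definition global_solution ::
  "real \<Rightarrow> (real \<Rightarrow> real) \<Rightarrow> (real \<Rightarrow> real) \<Rightarrow> (real \<Rightarrow> real) \<Rightarrow> bool" where
  "global_solution \<mu> a f x \<longleftrightarrow> continuous_on UNIV x \<and> (\<forall>t. dde_at \<mu> a f x t)"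

text \<open>
  Consecutive zeros are more than the delay \<open>1\<close> apart.  Quantifying over all pairs of distinct
  zeros expresses this and also excludes accumulating zeros, in particular \<open>x = 0\<close>, for which
  a condition on consecutive zeros would hold vacuously.
\<close>

definition slowly_oscillating :: "(real \<Rightarrow> real) \<Rightarrow> bool" where
  "slowly_oscillating x \<longleftrightarrow> (\<forall>s t. s < t \<and> x s = 0 \<and> x t = 0 \<longrightarrow> t - s > 1)"

end

theory Submission
  imports Defs "HOL-Analysis.Analysis"
begin

text \<open>
  Since the nonlinearity only sees the sign of the delayed state, any positive state on \<open>[-1,0]\<close> with
  value \<open>h\<close> at \<open>0\<close> has the same future as the constant state \<open>h\<close>. Solving the three linear pieces on
  \<open>[0,p1]\<close>, \<open>[p1,t1+1]\<close>, \<open>[t1+1,T]\<close> gives \<open>y T = k h + d = -h\<close>, and \<open>y < 0\<close> on \<open>[T-1,T]\<close>. Hence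
  \<open>- y (t + T)\<close> again starts from a positive state with value \<open>h\<close>, so it coincides with \<open>y\<close> for
  \<open>t \<ge> 0\<close>; the antiperiodic extension of \<open>y\<close> to the real line is the solution sought.
\<close>

text \<open>Integrating factor: \<open>g\<close> is continuous and its derivative vanishes off a
  finite set, so it is constant. The exceptional set \<open>S\<close> leaves room for the times at
  which \<open>dde_at\<close> is silent.\<close>

lemma linear_ode_solution:
  fixes w :: "real \<Rightarrow> real"
  assumes "\<mu> \<noteq> 0" and S: "finite S" and cont: "continuous_on {\<alpha>..\<beta>} w"
    and deriv: "\<And>t. \<alpha> < t \<Longrightarrow> t < \<beta> \<Longrightarrow> t \<notin> S \<Longrightarrow>
      (w has_real_derivative (- \<mu> * w t + c)) (at t)"
    and t: "\<alpha> \<le> t" "t \<le> \<beta>"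
  shows "w t = (w \<alpha> - c / \<mu>) * exp (- \<mu> * (t - \<alpha>)) + c / \<mu>"
proof -
  define g where "g s = (w s - c / \<mu>) * exp (\<mu> * (s - \<alpha>))" for s
  have "g t = g \<alpha>"
  proof (rule has_derivative_zero_unique_strong_interval[of "insert \<alpha> (insert \<beta> S)" \<alpha> \<beta> g])
    show "continuous_on {\<alpha>..\<beta>} g"
      unfolding g_def by (intro continuous_intros cont)
    fix s assume s: "s \<in> {\<alpha>..\<beta>} - insert \<alpha> (insert \<beta> S)"
    then have "(w has_real_derivative (- \<mu> * w s + c)) (at s)"
      by (intro deriv) auto
    then have "(g has_real_derivative 0) (at s)"
      unfolding g_def using \<open>\<mu> \<noteq> 0\<close>
      by (auto intro!: derivative_eq_intros simp: field_simps)
    then have "(g has_derivative (\<lambda>h. 0)) (at s)"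
      by (simp add: has_field_derivative_def mult.commute lambda_zero)
    then show "(g has_derivative (\<lambda>h. 0)) (at s within {\<alpha>..\<beta>})"
      by (simp add: has_derivative_at_withinI)
  qed (use S t in auto)
  then have "(w t - c / \<mu>) * exp (\<mu> * (t - \<alpha>)) = w \<alpha> - c / \<mu>"
    by (simp add: g_def)
  then have "(w \<alpha> - c / \<mu>) * exp (- \<mu> * (t - \<alpha>))
      = (w t - c / \<mu>) * (exp (\<mu> * (t - \<alpha>)) * exp (- \<mu> * (t - \<alpha>)))"
    by (metis mult.assoc)
  also have "exp (\<mu> * (t - \<alpha>)) * exp (- \<mu> * (t - \<alpha>)) = 1"
    by (simp flip: exp_add)
  finally show ?thesis by simp
qed

section \<open>The delay equation: locality, symmetry and uniqueness\<close>

lemma dde_atD: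
  assumes "dde_at \<mu> a f x t" "isCont a t" "x (t - 1) \<noteq> 0"
  shows "(x has_real_derivative (- \<mu> * x t + a t * f (x (t - 1)))) (at t)"
  using assms by (simp add: dde_at_def)

text \<open>\<open>dde_at\<close> depends only on the germ of the function at \<open>t\<close> and
  on its value at \<open>t - 1\<close>. This serves for an extension that equals a signed translate
  of \<open>y\<close> only near \<open>t\<close> and at \<open>t - 1\<close>.\<close>

lemma dde_at_transfer:
  assumes "dde_at \<mu> a f u t" and "\<forall>\<^sub>F s in nhds t. u s = v s" and "u (t - 1) = v (t - 1)"
  shows "dde_at \<mu> a f v t"
proof -
  have "u t = v t"
    using assms(2) by (rule eventually_nhds_x_imp_x)
  then show ?thesis
    using assms(1,3) DERIV_cong_ev[OF refl assms(2) refl] by (simp add: dde_at_def)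
qed

text \<open>The symmetry behind antiperiodicity: shifting by a period keeps \<open>a\<close>, and a
  factor that commutes with \<open>f\<close> passes through the equation. It is applied with
  \<open>c\<close> a power of -1.\<close>

lemma dde_at_scale_shift:
  assumes dde: "dde_at \<mu> a f y (t + \<tau>)"
    and per: "\<And>s. a (s + \<tau>) = a s"
    and c: "c \<noteq> 0" "\<And>x. f (c * x) = c * f x"
  shows "dde_at \<mu> a f (\<lambda>s. c * y (s + \<tau>)) t"
  unfolding dde_at_def
proof (intro impI, elim conjE)
  assume a: "isCont a t" and nz: "c * y (t - 1 + \<tau>) \<noteq> 0"
  have "isCont (\<lambda>s. a (s - \<tau>)) (t + \<tau>)"
    using a by (intro continuous_at_compose[of _ "\<lambda>s. s - \<tau>" a, unfolded o_def]) auto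
  moreover have "a (s - \<tau>) = a s" for s
    using per[of "s - \<tau>"] by simp
  ultimately have "isCont a (t + \<tau>)"
    by simp
  then have "(y has_real_derivative (- \<mu> * y (t + \<tau>) + a (t + \<tau>) * f (y (t + \<tau> - 1)))) (at (t + \<tau>))"
    using dde nz by (intro dde_atD) (auto simp: algebra_simps)
  then have "((\<lambda>s. y (s + \<tau>)) has_real_derivative
      (- \<mu> * y (t + \<tau>) + a (t + \<tau>) * f (y (t + \<tau> - 1)))) (at t)"
    by (simp add: DERIV_shift)
  from DERIV_cmult[OF this, of c]
  show "((\<lambda>s. c * y (s + \<tau>)) has_real_derivative
      (- \<mu> * (c * y (t + \<tau>)) + a t * f (c * y (t - 1 + \<tau>)))) (at t)"
    using per[of t] by (simp add: c algebra_simps)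
qed

text \<open>Method of steps. The delayed terms agree on each unit interval, so the difference solves
  w' = -\<mu> w off a finite set and stays 0. On [-1,0] the two functions may differ as long as
  \<open>f\<close> cannot tell them apart there.\<close>

lemma dde_unique:
  assumes "\<mu> \<noteq> 0"
    and cont: "continuous_on {0..b} u" "continuous_on {0..b} v"
    and dde: "\<And>t. 0 < t \<Longrightarrow> t < b \<Longrightarrow> dde_at \<mu> a f u t" "\<And>t. 0 < t \<Longrightarrow> t < b \<Longrightarrow> dde_at \<mu> a f v t"
    and init: "\<And>t. -1 \<le> t \<Longrightarrow> t \<le> 0 \<Longrightarrow> u t \<noteq> 0 \<and> v t \<noteq> 0 \<and> f (u t) = f (v t)"
    and zero: "u 0 = v 0"
    and fin: "finite {t. 0 < t \<and> t < b \<and> \<not> isCont a t}" "finite {t. 0 \<le> t \<and> t \<le> b \<and> v t = 0}"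
    and t: "0 \<le> t" "t \<le> b"
  shows "u t = v t"
proof -
  have step: "\<forall>t. 0 \<le> t \<and> t \<le> b \<and> t \<le> real n \<longrightarrow> u t = v t" for n
  proof (induction n)
    case 0
    then show ?case using zero by auto
  next
    case (Suc n)
    \<comment> \<open>The times without information: jumps of \<open>a\<close>, and zeros of
      \<open>v\<close> moved forward by the delay.\<close>
    define S where "S = {t. 0 < t \<and> t < b \<and> \<not> isCont a t}
      \<union> (\<lambda>t. t + 1) ` {t. 0 \<le> t \<and> t \<le> b \<and> v t = 0}"
    have eq: "u t - v t = (u 0 - v 0 - 0 / \<mu>) * exp (- \<mu> * (t - 0)) + 0 / \<mu>"
      if t: "0 \<le> t" "t \<le> min b (real (Suc n))" for t
    proof (rule linear_ode_solution[where S = S and \<beta> = "min b (real (Suc n))"])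
      show "finite S" using fin by (simp add: S_def)
      show "continuous_on {0..min b (real (Suc n))} (\<lambda>t. u t - v t)"
        by (intro continuous_intros continuous_on_subset[OF cont(1)] continuous_on_subset[OF cont(2)]) auto
      fix s assume s: "0 < s" "s < min b (real (Suc n))" "s \<notin> S"
      have "isCont a s" using s by (auto simp: S_def)
      have v: "v (s - 1) \<noteq> 0"
      proof (cases "s \<le> 1")
        case False
        \<comment> \<open>Writing \<open>s\<close> as \<open>s - 1 + 1\<close> exhibits it as a
          member of the shifted zero set if \<open>v\<close> vanishes at
          \<open>s - 1\<close>.\<close>
        have "v (s - 1) \<noteq> 0" if "s - 1 + 1 \<notin> S"
          using that False s unfolding S_def by (force simp: image_iff)
        then show ?thesis using s by simp
      qed (use init[of "s - 1"] s in auto)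
      have u: "u (s - 1) \<noteq> 0 \<and> f (u (s - 1)) = f (v (s - 1))"
      \<comment> \<open>Either \<open>s - 1\<close> lies in the initial interval, or in [0,n], where
        the induction hypothesis already identifies \<open>u\<close> and \<open>v\<close>.\<close>
      proof (cases "s \<le> 1")
        case False
        then have "u (s - 1) = v (s - 1)" using s Suc.IH by simp
        then show ?thesis using v by simp
      qed (use init[of "s - 1"] s in auto)
      have "((\<lambda>t. u t - v t) has_real_derivative
          (- \<mu> * u s + a s * f (u (s - 1))) - (- \<mu> * v s + a s * f (v (s - 1)))) (at s)"
        using u v s \<open>isCont a s\<close> by (intro DERIV_diff dde_atD dde) auto
      then show "((\<lambda>t. u t - v t) has_real_derivative (- \<mu> * (u s - v s) + 0)) (at s)"
        using u by (simp add: algebra_simps)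
    qed (use \<open>\<mu> \<noteq> 0\<close> t in auto)
    show ?case
    proof (intro allI impI)
      fix t assume "0 \<le> t \<and> t \<le> b \<and> t \<le> real (Suc n)"
      then show "u t = v t" using eq[of t] zero by simp
    qed
  qed
  obtain n where "t \<le> real n" using real_arch_simple by blast
  then show ?thesis using step[of n] t by auto
qed

lemma isCont_const_on_open:
  fixes a :: "real \<Rightarrow> real"
  assumes "\<And>s. l < s \<Longrightarrow> s < r \<Longrightarrow> a s = c" "l < t" "t < r"
  shows "isCont a t"
proof -
  have "\<forall>\<^sub>F s in nhds t. s \<in> {l<..<r}"
    using assms by (intro eventually_nhds_in_open) auto
  then have "\<forall>\<^sub>F s in nhds t. a s = c"
    by eventually_elim (use assms in auto)
  from isCont_cong[OF this] show ?thesis by simp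
qed

section \<open>Antiperiodic functions and their extension to the real line\<close>

lemma antiperiodic_multiple:
  fixes y :: "real \<Rightarrow> real"
  assumes "0 < T" "\<And>t. 0 \<le> t \<Longrightarrow> y (t + T) = - y t" "0 \<le> t"
  shows "y (t + real n * T) = (-1) ^ n * y t"
proof (induction n)
  case (Suc n)
  have "y (t + real (Suc n) * T) = y ((t + real n * T) + T)"
    by (simp add: algebra_simps)
  then show ?case
    using assms Suc by simp
qed simp

text \<open>Shift \<open>t\<close> by enough periods to reach the half-line and correct the sign.
  The choice of the number of periods is immaterial, since the shifts by \<open>m\<close> and by
  \<open>n\<close> periods are both comparable with the shift by m + n.\<close>

lemma antiperiodic_extension:
  fixes y :: "real \<Rightarrow> real"
  assumes T: "0 < T" and anti: "\<And>t. 0 \<le> t \<Longrightarrow> y (t + T) = - y t"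
  obtains x where "\<And>t n. 0 \<le> t + real n * T \<Longrightarrow> x t = (-1) ^ n * y (t + real n * T)"
    "\<And>t. x (t + T) = - x t"
proof -
  have "\<exists>n. 0 \<le> t + real n * T" for t
  proof -
    obtain n where "- t / T \<le> real n" using real_arch_simple by blast
    then have "0 \<le> t + real n * T" using T by (simp add: field_simps)
    then show ?thesis ..
  qed
  then obtain m where m: "\<And>t. 0 \<le> t + real (m t) * T" by metis
  define x where "x t = (-1) ^ m t * y (t + real (m t) * T)" for t
  have mult: "y (t + real i * T + real j * T) = (-1) ^ j * y (t + real i * T)"
    if "0 \<le> t + real i * T" for t i j
    using antiperiodic_multiple[of T y "t + real i * T" j] T anti that by simp
  have x: "x t = (-1) ^ n * y (t + real n * T)" if "0 \<le> t + real n * T" for t n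
  proof -
    have "(-1) ^ n * y (t + real (m t) * T) = (-1) ^ m t * y (t + real n * T)"
      using mult[OF m[of t], of n] mult[OF that, of "m t"] by (simp add: algebra_simps)
    then have "(-1) ^ n * ((-1) ^ n * y (t + real (m t) * T)) = (-1) ^ n * ((-1) ^ m t * y (t + real n * T))"
      by simp
    then have "y (t + real (m t) * T) = (-1) ^ n * ((-1) ^ m t * y (t + real n * T))"
      by (simp flip: mult.assoc power_mult_distrib)
    then have "x t = (-1) ^ m t * ((-1) ^ n * ((-1) ^ m t * y (t + real n * T)))"
      unfolding x_def by simp
    also have "\<dots> = ((-1) ^ m t * (-1) ^ m t) * ((-1) ^ n * y (t + real n * T))"
      by (simp only: ac_simps)
    also have "\<dots> = (-1) ^ n * y (t + real n * T)"
      by (simp flip: power_mult_distrib)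
    finally show ?thesis .
  qed
  have "x (t + T) = - x t" for t
  proof -
    have "x t = (-1) ^ Suc (m (t + T)) * y (t + real (Suc (m (t + T))) * T)"
      using m[of "t + T"] by (intro x) (simp add: algebra_simps)
    also have "\<dots> = - x (t + T)"
      by (simp add: x_def algebra_simps)
    finally show ?thesis by simp
  qed
  with x that show thesis by blast
qed

lemma antiperiodic_int_multiple:
  fixes x :: "real \<Rightarrow> real"
  assumes "\<And>t. x (t + T) = - x t"
  shows "x (t + of_int j * T) = 0 \<longleftrightarrow> x t = 0"
proof -
  have nat: "x (t + real n * T) = 0 \<longleftrightarrow> x t = 0" for n t
  proof (induction n)
    case (Suc n)
    have "x (t + real (Suc n) * T) = - x (t + real n * T)"
      using assms[of "t + real n * T"] by (simp add: algebra_simps)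
    then show ?case using Suc by simp
  qed simp
  show ?thesis
  proof (cases j)
    case (nonneg n)
    then show ?thesis using nat[of t n] by simp
  next
    \<comment> \<open>Here \<open>j\<close> is -(n + 1), so the natural-number case is run for
      \<open>Suc n\<close> steps upwards from the shifted point.\<close>
    case (neg n)
    then show ?thesis
      using nat[of "t + of_int j * T" "Suc n"] by (simp add: neg algebra_simps)
  qed
qed

text \<open>Zeros are invariant under shifts by \<open>T\<close>, so all of them lie in z + T Z;
  distinct ones are at least T > 1 apart.\<close>

lemma slowly_oscillating_antiperiodic:
  fixes x :: "real \<Rightarrow> real"
  assumes T: "T > 1" and anti: "\<And>t. x (t + T) = - x t"
    and zeros: "\<And>t. 0 \<le> t \<Longrightarrow> t < T \<Longrightarrow> x t = 0 \<Longrightarrow> t = z"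
  shows "slowly_oscillating x"
proof -
  have zero: "\<exists>j::int. t = z + of_int j * T" if "x t = 0" for t
  proof -
    define j where "j = \<lfloor>t / T\<rfloor>"
    have "of_int j \<le> t / T" "t / T < of_int j + 1"
      unfolding j_def by linarith+
    then have *: "0 \<le> t - of_int j * T" "t - of_int j * T < T"
      using T by (simp_all add: field_simps)
    have "x (t - of_int j * T) = 0"
      using antiperiodic_int_multiple[of x T "t - of_int j * T" j, OF anti] that by simp
    then have "t = z + of_int j * T"
      using zeros[OF *] by simp
    then show ?thesis ..
  qed
  show ?thesis
    unfolding slowly_oscillating_def
  proof (intro allI impI, elim conjE)
    fix s t assume "s < t" "x s = 0" "x t = 0"
    then obtain i j :: int where ij: "s = z + of_int i * T" "t = z + of_int j * T"
      using zero by blast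
    with \<open>s < t\<close> T have "i < j" by simp
    then have "1 \<le> real_of_int (j - i)" by linarith
    then have "1 * T \<le> real_of_int (j - i) * T"
      using T by (intro mult_right_mono) auto
    then show "t - s > 1" using ij T by (simp add: algebra_simps)
  qed
qed

text \<open>Both properties are local: near any time, \<open>x\<close> is a signed translate of
  \<open>y\<close> by a multiple of the period.\<close>

lemma antiperiodic_global_solution:
  assumes T: "0 < T" and per: "\<And>t. a (t + T) = a t"
    and odd: "\<And>x. f (- x) = - f x"
    and cont: "continuous_on {-1..} y"
    and dde: "\<And>t. t > 0 \<Longrightarrow> dde_at \<mu> a f y t"
    and x: "\<And>t n. 0 \<le> t + real n * T \<Longrightarrow> x t = (-1) ^ n * y (t + real n * T)"
  shows "global_solution \<mu> a f x"
proof -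
  have per': "a (s + real n * T) = a s" for s n
  proof (induction n)
    case (Suc n)
    then show ?case using per[of "s + real n * T"] by (simp add: algebra_simps)
  qed simp
  have *: "isCont x t \<and> dde_at \<mu> a f x t" for t
  proof -
    \<comment> \<open>The margin 2 keeps the shifted argument above 1 for all s > t - 1 and at least
      1 at the delayed time t - 1, so the formula for \<open>x\<close> holds at all points
      needed.\<close>
    obtain n where "(2 - t) / T \<le> real n" using real_arch_simple by blast
    then have n: "2 \<le> t + real n * T" using T by (simp add: field_simps)
    have ev: "\<forall>\<^sub>F s in nhds t. (-1) ^ n * y (s + real n * T) = x s"
    proof -
      have "\<forall>\<^sub>F s in nhds t. s \<in> {t - 1<..}"
        by (intro eventually_nhds_in_open) auto
      then show ?thesis
        by eventually_elim (use n in \<open>auto intro!: x[symmetric]\<close>)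
    qed
    have "isCont y (t + real n * T)"
      using cont n by (intro continuous_on_interior[of "{-1..}"]) auto
    then have "isCont (\<lambda>s. (-1) ^ n * y (s + real n * T)) t"
      by (intro continuous_intros continuous_at_compose[of t "\<lambda>s. s + real n * T" y, unfolded o_def]) auto
    then have "isCont x t"
      using isCont_cong[OF ev] by simp
    moreover have "dde_at \<mu> a f (\<lambda>s. (-1) ^ n * y (s + real n * T)) t"
    proof (rule dde_at_scale_shift)
      show "f ((-1) ^ n * x) = (-1) ^ n * f x" for x
        by (cases "even n") (auto simp: odd)
    qed (use n per' in \<open>auto intro!: dde\<close>)
    then have "dde_at \<mu> a f x t"
      by (rule dde_at_transfer[OF _ ev]) (use n in \<open>auto intro!: x[symmetric]\<close>)
    ultimately show ?thesis ..
  qed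
  then show ?thesis
    by (auto simp: global_solution_def continuous_on_eq_continuous_at)
qed

theorem corollary2p4:
  fixes \<mu> a1 a2 p1 p2 T k d h t1 :: real
    and a y :: "real \<Rightarrow> real"
  assumes pos: "\<mu> > 0" "a1 > 0" "a2 > 0" "p1 > 0" "p2 > 0"
    and T: "T = p1 + p2"
    and a_periodic: "\<forall>t. a (t + T) = a t"
    and a_first: "\<forall>t. 0 \<le> t \<and> t < p1 \<longrightarrow> a t = a1"
    and a_second: "\<forall>t. p1 \<le> t \<and> t < T \<longrightarrow> a t = a2"
    and k: "k = (1 - 2 * (a2 / a1) * exp \<mu>) * exp (- \<mu> * T)"
    and d: "d = (a2 - a1) / \<mu> * exp (- \<mu> * p2) + a1 / \<mu> * exp (- \<mu> * T)
                + a2 / \<mu> * (1 - 2 * exp (- \<mu> * (T - 1)))"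
    and k_bound: "\<bar>k\<bar> < 1"
    and d_neg: "d < 0"
    and h: "h = - d / (k + 1)"
    and p2_gt: "p2 > 1"
    and t1: "t1 = 1 / \<mu> * ln ((\<mu> * h + a1) / a1)"
    and t1_order: "t1 < p1" "p1 < t1 + 1" "t1 + 1 < T"
    and y_sol: "ivp_solution \<mu> a neg_sign (\<lambda>_. h) y"
    and y_neg: "\<forall>t. t1 < t \<and> t \<le> T \<longrightarrow> y t < 0"
  shows "h > 0 \<and> (\<exists>x. global_solution \<mu> a neg_sign x
           \<and> slowly_oscillating x
           \<and> (\<forall>t. x (t + 2 * T) = x t)
           \<and> (\<forall>t. x (t + T) = - x t)
           \<and> (\<forall>t\<ge>0. x t = y t))"
proof -
  have T0: "0 < T" "1 < T" "p1 < T" using pos T p2_gt by auto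
  have cont: "continuous_on {-1..} y" and init: "\<And>t. -1 \<le> t \<Longrightarrow> t \<le> 0 \<Longrightarrow> y t = h"
    and dde: "\<And>t. t > 0 \<Longrightarrow> dde_at \<mu> a neg_sign y t"
    using y_sol by (auto simp: ivp_solution_def)
  have cont': "continuous_on {l..r} y" if "-1 \<le> l" for l r
    using cont by (rule continuous_on_subset) (use that in auto)
  have k1: "k + 1 > 0" using k_bound by auto
  then have h0: "h > 0" using h d_neg by (simp add: divide_neg_pos)
  have "(\<mu> * h + a1) / a1 > 1" using pos h0 by (simp add: field_simps)
  then have t1_pos: "t1 > 0" and exp_t1: "exp (\<mu> * t1) = (\<mu> * h + a1) / a1"
    using t1 pos by (auto simp: ln_gt_zero)
  have aC1: "isCont a t" if "0 < t" "t < p1" for t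
    by (rule isCont_const_on_open[of 0 p1 a a1]) (use that a_first in auto)
  have aC2: "isCont a t" if "p1 < t" "t < T" for t
    by (rule isCont_const_on_open[of p1 T a a2]) (use that a_second in auto)

  \<comment> \<open>The explicit solution on [0,T]\<close>
  define g where "g t = (h + a1 / \<mu>) * exp (- \<mu> * t) - a1 / \<mu>" for t
  \<comment> \<open>\<open>g\<close> solves g' = -\<mu> g - a1 with g(0) = h. This form shows its
    sign: \<open>t1\<close> is its zero, and \<open>g\<close> is positive before it.\<close>
  have g_factor: "g t = a1 / \<mu> * (exp (\<mu> * (t1 - t)) - 1)" for t
  proof -
    have "exp (\<mu> * (t1 - t)) = (\<mu> * h + a1) / a1 * exp (- \<mu> * t)"
      by (simp add: right_diff_distrib exp_diff exp_t1 exp_minus field_simps)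
    then show ?thesis using pos by (simp add: g_def field_simps)
  qed
  have g_pos: "g t > 0" if "t < t1" for t
    using that pos by (simp add: g_factor)
  \<comment> \<open>Method of steps again. For s < p1 < t1 + 1 the delayed time s - 1 precedes
    \<open>t1\<close>, where the solution found so far is positive, so the forcing remains
    \<open>- a1\<close>.\<close>
  have y_g_step: "\<forall>t. 0 \<le> t \<and> t \<le> p1 \<and> t \<le> real n \<longrightarrow> y t = g t" for n
  proof (induction n)
    case 0
    then show ?case using init[of 0] by (auto simp: g_def)
  next
    case (Suc n)
    have "y t = (y 0 - - a1 / \<mu>) * exp (- \<mu> * (t - 0)) + - a1 / \<mu>"
      if t: "0 \<le> t" "t \<le> min p1 (real (Suc n))" for t
    proof (rule linear_ode_solution[where S = "{}" and \<beta> = "min p1 (real (Suc n))"])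
      fix s assume s: "0 < s" "s < min p1 (real (Suc n))"
      have "y (s - 1) > 0"
      proof (cases "s \<le> 1")
        case False
        then have "y (s - 1) = g (s - 1)" using Suc.IH s by simp
        then show ?thesis using g_pos[of "s - 1"] s t1_order by simp
      qed (use init[of "s - 1"] s h0 in auto)
      then show "(y has_real_derivative - \<mu> * y s + - a1) (at s)"
        using dde_atD[OF dde[of s] aC1[of s]] a_first s by (simp add: neg_sign_def)
    qed (use pos t cont'[of 0] in auto)
    then show ?case
      using init[of 0] by (auto simp: g_def)
  qed
  have y_g: "y t = g t" if "0 \<le> t" "t \<le> p1" for t
  proof -
    obtain n where "t \<le> real n" using real_arch_simple by blast
    then show ?thesis using y_g_step[of n] that by auto
  qed
  have y_pos: "y t > 0" if "-1 \<le> t" "t < t1" for t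
  proof (cases "t \<le> 0")
    case False
    then show ?thesis using y_g[of t] g_pos[of t] that t1_order by simp
  qed (use init[of t] that h0 in auto)

  \<comment> \<open>Now \<open>a\<close> has jumped to \<open>a2\<close>, but the delayed state is
    still positive until t1 + 1.\<close>
  have mid: "y (t1 + 1) = (y p1 - - a2 / \<mu>) * exp (- \<mu> * (t1 + 1 - p1)) + - a2 / \<mu>"
  proof (rule linear_ode_solution[where S = "{}" and \<beta> = "t1 + 1"])
    fix s assume s: "p1 < s" "s < t1 + 1"
    then have "y (s - 1) > 0" using pos by (intro y_pos) auto
    then show "(y has_real_derivative - \<mu> * y s + - a2) (at s)"
      using dde_atD[OF dde[of s] aC2[of s]] a_second s pos t1_order by (simp add: neg_sign_def)
  qed (use pos t1_order cont'[of p1] in auto)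
  \<comment> \<open>After t1 + 1 the delayed time lies in (t1,T), where \<open>y\<close> is
    negative, so the forcing flips to \<open>+ a2\<close>.\<close>
  have last: "y T = (y (t1 + 1) - a2 / \<mu>) * exp (- \<mu> * (T - (t1 + 1))) + a2 / \<mu>"
  proof (rule linear_ode_solution[where S = "{}" and \<beta> = T])
    fix s assume s: "t1 + 1 < s" "s < T"
    then have "y (s - 1) < 0" using y_neg by auto
    then show "(y has_real_derivative - \<mu> * y s + a2) (at s)"
      using dde_atD[OF dde[of s] aC2[of s]] a_second s pos t1_order by (simp add: neg_sign_def)
  qed (use pos t1_order t1_pos cont'[of "t1 + 1"] in auto)
  have yT: "y T = - h"
  proof -
    define E where "E = exp (- \<mu> * (T - (t1 + 1)))"
    have e1: "exp (- \<mu> * (t1 + 1 - p1)) * E = exp (- \<mu> * p2)"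
      unfolding E_def exp_add[symmetric] by (rule arg_cong[where f = exp]) (simp add: T algebra_simps)
    have e2: "exp (- \<mu> * p1) * exp (- \<mu> * p2) = exp (- \<mu> * T)"
      unfolding exp_add[symmetric] by (rule arg_cong[where f = exp]) (simp add: T algebra_simps)
    \<comment> \<open>Through \<open>exp_t1\<close> the factor exp(\<mu> t1) is affine in
      \<open>h\<close>. Hence so is \<open>E\<close>, and with it \<open>y T\<close>, although the
      switching time depends on \<open>h\<close> logarithmically.\<close>
    have e3: "E = exp (- \<mu> * T) * exp \<mu> * exp (\<mu> * t1)"
      unfolding E_def exp_add[symmetric] by (rule arg_cong[where f = exp]) (simp add: algebra_simps)
    have e4: "exp (- \<mu> * (T - 1)) = exp (- \<mu> * T) * exp \<mu>"
      unfolding exp_add[symmetric] by (rule arg_cong[where f = exp]) (simp add: algebra_simps)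
    have "y T = (y p1 + a2 / \<mu>) * (exp (- \<mu> * (t1 + 1 - p1)) * E) - 2 * (a2 / \<mu>) * E + a2 / \<mu>"
      unfolding last mid E_def[symmetric] by (simp add: algebra_simps)
    also have "y p1 = (h + a1 / \<mu>) * exp (- \<mu> * p1) - a1 / \<mu>"
      using y_g[of p1] pos by (simp add: g_def)
    also have "((h + a1 / \<mu>) * exp (- \<mu> * p1) - a1 / \<mu> + a2 / \<mu>)
        * (exp (- \<mu> * (t1 + 1 - p1)) * E) =
        (h + a1 / \<mu>) * exp (- \<mu> * T) + (a2 - a1) / \<mu> * exp (- \<mu> * p2)"
      unfolding e1 e2[symmetric] by (simp add: algebra_simps diff_divide_distrib)
    also have "2 * (a2 / \<mu>) * E = 2 * (a2 / a1) * exp \<mu> * exp (- \<mu> * T) * h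
        + a2 / \<mu> * (2 * exp (- \<mu> * (T - 1)))"
      unfolding e3 e4 exp_t1 using pos by (simp add: field_simps)
    finally have "y T = k * h + d"
      unfolding k d by (simp add: algebra_simps)
    \<comment> \<open>\<open>h\<close> was chosen as the fixed point of the map sending h to -(k h +
      d).\<close>
    moreover have "h * (k + 1) = - d" using h k1 by simp
    ultimately show ?thesis by (simp add: algebra_simps)
  qed

  \<comment> \<open>Antiperiodicity of \<open>y\<close> on the half-line\<close>
  have neg_sign_scale: "neg_sign ((-1) ^ n * x) = (-1) ^ n * neg_sign x" for n x
    by (cases "even n") (auto simp: neg_sign_def)
  have per: "a (s + real n * T) = a s" for s n
  proof (induction n)
    case (Suc n)
    then show ?case using a_periodic[rule_format, of "s + real n * T"] by (simp add: algebra_simps)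
  qed simp
  have y0: "y t = 0 \<Longrightarrow> t = t1" if "0 \<le> t" "t \<le> T" for t
    using y_pos[of t] y_neg that by (cases t t1 rule: linorder_cases) auto
  \<comment> \<open>In each period the sign-corrected solution repeats \<open>y\<close> on [0,T].
    Restricting \<open>t\<close> to [0,T] means that uniqueness needs the zeros of \<open>y\<close>
    on [0,T] only.\<close>
  have restart: "(-1) ^ n * y (t + real n * T) = y t" if t: "0 \<le> t" "t \<le> T" for n t
    using t
  proof (induction n arbitrary: t)
    case (Suc n)
    \<comment> \<open>As T > 1, s + T lies in [0,T], so the induction hypothesis reduces the new
      initial state to the negative of the last unit piece of \<open>y\<close> on [0,T].\<close>
    have prev: "(-1) ^ Suc n * y (s + real (Suc n) * T) = - y (s + T)" if "-1 \<le> s" "s \<le> 0" for s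
      using Suc.IH[of "s + T"] that T0 by (simp add: algebra_simps)
    show ?case
    proof (rule dde_unique[of \<mu> T "\<lambda>s. (-1) ^ Suc n * y (s + real (Suc n) * T)" y a neg_sign])
      show "continuous_on {0..T} (\<lambda>s. (-1) ^ Suc n * y (s + real (Suc n) * T))"
        by (intro continuous_intros continuous_on_compose2[OF cont])
          (use T0 in \<open>auto intro: order_trans[of _ 0]\<close>)
      show "dde_at \<mu> a neg_sign (\<lambda>s. (-1) ^ Suc n * y (s + real (Suc n) * T)) s" if "0 < s" for s
        by (rule dde_at_scale_shift)
          (use that T0 neg_sign_scale[of "Suc n"] per[of _ "Suc n"] in \<open>auto intro!: dde add_pos_nonneg\<close>)
      show "(-1) ^ Suc n * y (s + real (Suc n) * T) \<noteq> 0 \<and> y s \<noteq> 0 \<and>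
          neg_sign ((-1) ^ Suc n * y (s + real (Suc n) * T)) = neg_sign (y s)"
        if "-1 \<le> s" "s \<le> 0" for s
      proof -
        have "y (s + T) < 0" using y_neg that t1_order by auto
        then show ?thesis
          unfolding prev[OF that] using init[OF that] h0 by (simp add: neg_sign_def)
      qed
      show "(-1) ^ Suc n * y (0 + real (Suc n) * T) = y 0"
        using prev[of 0] yT init[of 0] by simp
      have "{t. 0 < t \<and> t < T \<and> \<not> isCont a t} \<subseteq> {p1}"
        using aC1 aC2 by (auto simp: not_less_iff_gr_or_eq) (metis linorder_neqE)
      then show "finite {t. 0 < t \<and> t < T \<and> \<not> isCont a t}"
        by (rule finite_subset) simp
      have "{t. 0 \<le> t \<and> t \<le> T \<and> y t = 0} \<subseteq> {t1}"
        using y0 by auto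
      then show "finite {t. 0 \<le> t \<and> t \<le> T \<and> y t = 0}"
        by (rule finite_subset) simp
    qed (use pos Suc.prems cont' dde in auto)
  qed simp
  have anti: "y (t + T) = - y t" if "0 \<le> t" for t
  proof -
    define n where "n = nat \<lfloor>t / T\<rfloor>"
    have "real n \<le> t / T" "t / T < real n + 1"
      unfolding n_def using that T0 by (auto simp: of_nat_nat)
    then have s: "0 \<le> t - real n * T" "t - real n * T \<le> T"
      using T0 by (simp_all add: field_simps)
    \<comment> \<open>Both sides equal \<open>y\<close> at the remainder of \<open>t\<close> modulo
      \<open>T\<close>, by \<open>restart\<close> with \<open>n\<close> and
      \<open>Suc n\<close>.\<close>
    have "(-1) ^ n * y t = (-1) ^ Suc n * y (t + T)"
      using restart[OF s, of n] restart[OF s, of "Suc n"] by (simp add: algebra_simps)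
    then show ?thesis by (cases "even n") auto
  qed

  \<comment> \<open>The periodic solution on the real line\<close>
  obtain x where x: "\<And>t n. 0 \<le> t + real n * T \<Longrightarrow> x t = (-1) ^ n * y (t + real n * T)"
    and x_anti: "\<And>t. x (t + T) = - x t"
    using antiperiodic_extension[of T y] T0 anti by metis
  have x_y: "x t = y t" if "t \<ge> 0" for t
    using x[of t 0] that by simp
  have "global_solution \<mu> a neg_sign x"
    by (rule antiperiodic_global_solution[of T a neg_sign y])
      (use T0 a_periodic cont dde x in \<open>auto simp: neg_sign_def\<close>)
  moreover have "slowly_oscillating x"
    by (rule slowly_oscillating_antiperiodic[of T x t1]) (use T0 x_anti x_y y0 in auto)
  moreover have "x (t + 2 * T) = x t" for t
    using x_anti[of t] x_anti[of "t + T"] by (simp add: algebra_simps)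
  ultimately show ?thesis
    using h0 x_anti x_y by blast
qed

end
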